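(* Let $N\ge 4$ be an integer. Then: (i) $K_N(\theta,r)\ge 0$ for all $(\theta,r)\in B_1^+(N)$; (ii) $\frac{1}{2\pi}\int_0^{2\pi}K_N(\psi,r)\,d\psi=1$ for all $0\le r<1$; (iii) for every finite set $\mathcal Z\subset[0,2\pi)$ and every $g\in C_{\mathcal Z}$, $$\inf_{\partial B_1} g\;\le\;(\Delta_1^{-1}P_N^1 g)(\theta,r)\;\le\;\sup_{\partial B_1} g\qquad\text{for all }(\theta,r)\in B_1^+(N).$$
   Context: $B_1\subset\mathbb R^2$ is the open unit disc; points of $B_1$ are written in polar coordinates $(\theta,r)$, meaning $r(\cos\theta,\sin\theta)$, and $\partial B_1$ is parametrized by the angle $\theta\in[0,2\pi)$, functions on $\partial B_1$ being identified with $2\pi$-periodic functions of $\theta$. For a finite (possibly empty) set $\mathcal Z\subset[0,2\pi)$, $C_{\mathcal Z}$ is the space of real functions on $\partial B_1$ that are continuous except possibly at the points of $\mathcal Z$, where left and right limits exist (and are finite). $U_N^1:=\{\alpha_0+\sum_{n=1}^N(\alpha_n\cos(n\theta)+\beta_n\sin(n\theta)) : \alpha_n,\beta_n\in\mathbb R\}\subset L^2(\partial B_1)$, and $P_N^1:L^2(\partial B_1)\to U_N^1$ is the $L^2$-orthogonal projection. $\Delta_1^{-1}$ denotes harmonic extension from $\partial B_1$ to $B_1$: $(\Delta_1^{-1}h)(\theta,r)=\frac1{2\pi}\int_0^{2\pi}K(\theta-\theta',r)h(\theta')\,d\theta'$ with the Poisson kernel $K(\psi,r)=\frac{1-r^2}{1-2r\cos\psi+r^2}$,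 $0\le r<1$. $K_N(\psi,r):=1+2\sum_{n=1}^N r^n\cos(n\psi)$. $r_N^\ast:=\left(1-2\,\frac{\ln(2(N+1))}{N+1}\right)^{1/2}$ and $B_1^+(N):=\{(\theta,r)\in B_1 : \theta\in[0,2\pi],\ 0\le r\le r_N^\ast\}$. *)

theory Defs
  imports "HOL-Analysis.Analysis"
begin

text \<open>
  The plane is identified with \<^typ>\<open>complex\<close>, so the point with polar coordinates
  \<open>(\<theta>, r)\<close> is \<open>rcis r \<theta>\<close>. Functions on the unit circle are represented
  by \<open>2\<pi>\<close>-periodic functions of the angle.
\<close>

definition circle_functions :: "(real \<Rightarrow> real) set" where
  "circle_functions = {g. \<forall>\<theta>. g (\<theta> + 2 * pi) = g \<theta>}"

text \<open>
  One-sided limits exist at the points of \<open>Z\<close>; the values of \<open>g\<close> there are arbitrary.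
  By periodicity, \<open>isCont g 0\<close> is continuity on the circle at the angle \<open>0\<close>.
\<close>

definition piecewise_C :: "real set \<Rightarrow> (real \<Rightarrow> real) set" where
  "piecewise_C Z = {g \<in> circle_functions.
     (\<forall>\<theta>\<in>{0..<2 * pi} - Z. isCont g \<theta>) \<and>
     (\<forall>\<theta>\<in>Z. (\<exists>l. (g \<longlongrightarrow> l) (at_left \<theta>)) \<and> (\<exists>l. (g \<longlongrightarrow> l) (at_right \<theta>)))}"

definition trig_polys :: "nat \<Rightarrow> (real \<Rightarrow> real) set" where
  "trig_polys N = {u. \<exists>\<alpha> \<beta> :: nat \<Rightarrow> real.
     u = (\<lambda>\<theta>. \<alpha> 0 + (\<Sum>n=1..N. \<alpha> n * cos (real n * \<theta>) + \<beta> n * sin (real n * \<theta>)))}"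

definition circle_inner :: "(real \<Rightarrow> real) \<Rightarrow> (real \<Rightarrow> real) \<Rightarrow> real" where
  "circle_inner f h = (LINT \<theta>:{0..2 * pi}|lborel. f \<theta> * h \<theta>)"

text \<open>
  The \<open>L\<^sup>2\<close>-orthogonal projection, meaningful for square-integrable \<open>g\<close>. It is unique as a
  function, not only almost everywhere, because trigonometric polynomials are continuous.
\<close>

definition trig_proj :: "nat \<Rightarrow> (real \<Rightarrow> real) \<Rightarrow> real \<Rightarrow> real" where
  "trig_proj N g = (THE u. u \<in> trig_polys N \<and>
     (\<forall>v\<in>trig_polys N. circle_inner (\<lambda>\<theta>. g \<theta> - u \<theta>) v = 0))"

definition poisson_kernel :: "real \<Rightarrow> real \<Rightarrow> real" where
  "poisson_kernel \<psi> r = (1 - r\<^sup>2) / (1 - 2 * r * cos \<psi> + r\<^sup>2)"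

definition harmonic_extension :: "(real \<Rightarrow> real) \<Rightarrow> real \<Rightarrow> real \<Rightarrow> real" where
  "harmonic_extension h \<theta> r =
     1 / (2 * pi) * (LINT \<phi>:{0..2 * pi}|lborel. poisson_kernel (\<theta> - \<phi>) r * h \<phi>)"

definition truncated_kernel :: "nat \<Rightarrow> real \<Rightarrow> real \<Rightarrow> real" where
  "truncated_kernel N \<psi> r = 1 + 2 * (\<Sum>n=1..N. r ^ n * cos (real n * \<psi>))"

text \<open>The quantity under the root is positive for \<open>N \<ge> 4\<close>.\<close>

definition r_star :: "nat \<Rightarrow> real" where
  "r_star N = sqrt (1 - 2 * (ln (2 * (real N + 1)) / (real N + 1)))"

definition B1_plus :: "nat \<Rightarrow> (real \<times> real) set" where
  "B1_plus N = {(\<theta>, r). rcis r \<theta> \<in> ball 0 1 \<and> \<theta> \<in> {0..2 * pi} \<and> 0 \<le> r \<and> r \<le> r_star N}"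

end

theory Submission
  imports Defs
begin

text \<open>
  Summing the geometric series shows that \<open>K\<^sub>N\<close> is the Poisson kernel plus an error controlled by
  \<open>2 r^(N+1)\<close>; the radius \<open>r_star N\<close> is chosen so that \<open>2 r^(N+1) \<le> 1 - r\<close>, which makes \<open>K\<^sub>N\<close>
  nonnegative. The error also tends to \<open>0\<close> uniformly in the angle as \<open>N\<close> grows, and \<open>K\<^sub>M\<close>, \<open>K\<^sub>N\<close>
  with \<open>M \<ge> N\<close> agree against trigonometric polynomials of degree \<open>N\<close>. Hence the harmonic extension
  of \<open>trig_proj N g\<close> is its convolution with \<open>K\<^sub>N\<close>, and, as \<open>K\<^sub>N(\<theta> - \<cdot>, r)\<close> is itself a trigonometric
  polynomial of degree \<open>N\<close>, also the convolution of \<open>g\<close> with \<open>K\<^sub>N\<close>: an average of \<open>g\<close> against a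
  probability density.
\<close>

section \<open>The truncated kernel: closed form, positivity, distance to the Poisson kernel\<close>

lemma truncated_kernel_closed_form:
  "(1 - 2 * r * cos \<psi> + r\<^sup>2) * truncated_kernel N \<psi> r =
    1 - r\<^sup>2 - 2 * r ^ Suc N * (cos (real (Suc N) * \<psi>) - r * cos (real N * \<psi>))"
proof (induction N)
  case 0
  show ?case by (simp add: truncated_kernel_def power2_eq_square algebra_simps)
next
  case (Suc N)
  \<comment> \<open>Splitting this product cancels the \<open>cos (real N * \<psi>)\<close> in the
    old remainder and leaves exactly the remainder for \<open>Suc N\<close>.\<close>
  have *: "2 * cos \<psi> * cos (real (Suc N) * \<psi>) = cos (real N * \<psi>) + cos (real (Suc (Suc N)) * \<psi>)"
  proof -
    have "real N * \<psi> = real (Suc N) * \<psi> - \<psi>" "real (Suc (Suc N)) * \<psi> = real (Suc N) * \<psi> + \<psi>"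
      by (simp_all add: algebra_simps)
    then show ?thesis by (simp only: cos_add cos_diff) simp
  qed
  have "truncated_kernel (Suc N) \<psi> r = truncated_kernel N \<psi> r + 2 * r ^ Suc N * cos (real (Suc N) * \<psi>)"
    by (simp add: truncated_kernel_def algebra_simps)
  then have "(1 - 2 * r * cos \<psi> + r\<^sup>2) * truncated_kernel (Suc N) \<psi> r =
     1 - r\<^sup>2 - 2 * r ^ Suc N * (cos (real (Suc N) * \<psi>) - r * cos (real N * \<psi>))
     + 2 * r ^ Suc N * (cos (real (Suc N) * \<psi>) - r * (2 * cos \<psi> * cos (real (Suc N) * \<psi>))
        + r\<^sup>2 * cos (real (Suc N) * \<psi>))"
    using Suc.IH by (simp add: algebra_simps del: power_Suc of_nat_Suc)
  also have "\<dots> = 1 - r\<^sup>2 - 2 * r ^ Suc (Suc N) *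
      (cos (real (Suc (Suc N)) * \<psi>) - r * cos (real (Suc N) * \<psi>))"
    unfolding * by (simp add: algebra_simps power2_eq_square del: of_nat_Suc)
  finally show ?case .
qed

text \<open>The denominator is the squared distance from 1 to \<open>rcis r \<psi>\<close>. A lower
  bound free of \<open>\<psi>\<close> makes the later error estimate uniform in the angle.\<close>

lemma poisson_denominator_ge:
  assumes "0 \<le> (r::real)"
  shows "(1 - r)\<^sup>2 \<le> 1 - 2 * r * cos \<psi> + r\<^sup>2"
proof -
  have "r * cos \<psi> \<le> r * 1" using assms by (intro mult_left_mono) auto
  then show ?thesis by (simp add: power2_eq_square algebra_simps)
qed

lemma poisson_denominator_pos:
  assumes "0 \<le> (r::real)" "r < 1"
  shows "0 < 1 - 2 * r * cos \<psi> + r\<^sup>2"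
  using poisson_denominator_ge[OF assms(1), of \<psi>] assms(2) zero_less_power[of "1 - r" 2]
  by linarith

lemma abs_cos_diff_le:
  assumes "0 \<le> (r::real)"
  shows "\<bar>cos a - r * cos b\<bar> \<le> 1 + r"
proof -
  have "\<bar>r * cos b\<bar> \<le> r * 1"
    using assms unfolding abs_mult by (intro mult_mono) auto
  then show ?thesis using abs_cos_le_one[of a] by linarith
qed

text \<open>In the closed form the oscillating remainder is at most
  \<open>2 * r ^ Suc N * (1 + r)\<close>, hence at most \<open>(1 - r) * (1 + r)\<close>, the
  numerator of the Poisson kernel.\<close>

lemma truncated_kernel_nonneg:
  assumes r: "0 \<le> r" "r < 1" and *: "2 * r ^ Suc N \<le> 1 - r"
  shows "0 \<le> truncated_kernel N \<psi> r"
proof -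
  have "2 * r ^ Suc N * (cos (real (Suc N) * \<psi>) - r * cos (real N * \<psi>)) \<le> 2 * r ^ Suc N * (1 + r)"
    using abs_cos_diff_le[OF r(1), of "real (Suc N) * \<psi>" "real N * \<psi>"] r
    by (intro mult_left_mono) auto
  also have "\<dots> \<le> (1 - r) * (1 + r)"
    using * r by (intro mult_right_mono) auto
  also have "\<dots> = 1 - r\<^sup>2" by (simp add: power2_eq_square algebra_simps)
  finally have "0 \<le> (1 - 2 * r * cos \<psi> + r\<^sup>2) * truncated_kernel N \<psi> r"
    unfolding truncated_kernel_closed_form by linarith
  then show ?thesis
    using poisson_denominator_pos[OF r, of \<psi>] by (simp add: zero_le_mult_iff)
qed

text \<open>The difference is the remainder of the closed form over the denominator; for fixed
  \<open>r\<close> the bound decays geometrically in \<open>N\<close>.\<close>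

lemma poisson_kernel_approx:
  assumes r: "0 \<le> r" "r < 1"
  shows "\<bar>poisson_kernel \<psi> r - truncated_kernel N \<psi> r\<bar> \<le> 2 * r ^ Suc N * (1 + r) / (1 - r)\<^sup>2"
proof -
  let ?d = "1 - 2 * r * cos \<psi> + r\<^sup>2"
  have d: "0 < ?d" "(1 - r)\<^sup>2 \<le> ?d"
    using poisson_denominator_pos[OF r] poisson_denominator_ge[OF r(1)] by auto
  let ?e = "2 * r ^ Suc N * (cos (real (Suc N) * \<psi>) - r * cos (real N * \<psi>))"
  have "truncated_kernel N \<psi> r = (1 - r\<^sup>2 - ?e) / ?d"
    using truncated_kernel_closed_form[of r \<psi> N] d
    by (metis less_irrefl nonzero_mult_div_cancel_left)
  then have "poisson_kernel \<psi> r - truncated_kernel N \<psi> r = ?e / ?d"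
    by (simp add: poisson_kernel_def diff_divide_distrib)
  then have "\<bar>poisson_kernel \<psi> r - truncated_kernel N \<psi> r\<bar> = \<bar>?e\<bar> / ?d"
    using d by (simp add: abs_divide)
  also have "\<dots> \<le> 2 * r ^ Suc N * (1 + r) / (1 - r)\<^sup>2"
  proof (rule frac_le)
    show "\<bar>?e\<bar> \<le> 2 * r ^ Suc N * (1 + r)"
      unfolding abs_mult using r abs_cos_diff_le[OF r(1)]
      by (intro mult_mono) auto
  qed (use r d in auto)
  finally show ?thesis .
qed

text \<open>With \<open>M\<close> and \<open>L\<close> as in the proof, both sides are compared with
  \<open>1 / M \<le> L / M\<close>: the left one is at most \<open>1 / M\<close>, the right one at
  least \<open>L / M\<close>.\<close>

lemma r_star_power_le:
  assumes N: "4 \<le> N" and r: "0 \<le> r" "r \<le> r_star N" "r < 1"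
  shows "2 * r ^ Suc N \<le> 1 - r"
proof -
  define M where "M = real N + 1"
  define L where "L = ln (2 * M)"
  have M: "5 \<le> M" using N by (simp add: M_def)
  have "exp 1 \<le> 2 * M" using exp_le M by linarith
  then have L: "1 \<le> L"
    unfolding L_def using M by (subst ln_ge_iff) auto
  have r_star: "r_star N = sqrt (1 - 2 * (L / M))"
    by (simp add: r_star_def L_def M_def)
  \<comment> \<open>\<open>sqrt\<close> is odd on the reals, so a nonnegative root forces a
    nonnegative radicand and no numerical estimate of the logarithm is made.\<close>
  have "0 \<le> r_star N" using r by linarith
  then have nonneg: "0 \<le> 1 - 2 * (L / M)" by (simp add: r_star)
  have r2: "r\<^sup>2 \<le> 1 - 2 * (L / M)"
    using power_mono[OF r(2,1), of 2] nonneg by (simp add: r_star)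
  have "L / M \<le> 1 - r"
  proof -
    \<comment> \<open>This gives \<open>1 - r\<close> at least half of \<open>1 - r\<^sup>2\<close>;
      the factor 2 in \<open>r_star\<close> absorbs the half.\<close>
    have "2 * r \<le> 1 + r\<^sup>2"
      using sum_squares_ge_zero[of "1 - r" 0] by (simp add: power2_eq_square algebra_simps)
    with r2 show ?thesis by linarith
  qed
  moreover have "2 * r ^ Suc N \<le> 1 / M"
  proof -
    have "r ^ Suc N \<le> exp (- L)"
    proof -
      \<comment> \<open>The bound is on \<open>r\<^sup>2\<close>, so the squares are compared:
        \<open>1 + x \<le> exp x\<close> turns it into an exponential whose power \<open>M\<close>
        is \<open>exp (- 2 * L)\<close>.\<close>
      have "(r ^ Suc N)\<^sup>2 = (r\<^sup>2) ^ Suc N"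
        by (simp only: power_mult[symmetric] mult.commute)
      also have "\<dots> \<le> exp (- 2 * (L / M)) ^ Suc N"
        using r2 exp_ge_add_one_self[of "- 2 * (L / M)"] by (intro power_mono) auto
      also have "\<dots> = exp (M * (- 2 * (L / M)))"
        by (subst exp_of_nat_mult[symmetric]) (simp add: M_def add.commute)
      also have "M * (- 2 * (L / M)) = 2 * (- L)" using M by simp
      also have "exp (2 * (- L)) = (exp (- L))\<^sup>2" by (rule exp_double)
      finally show ?thesis by (rule power2_le_imp_le) simp
    qed
    also have "exp (- L) = 1 / (2 * M)"
      unfolding exp_minus L_def using M by (simp add: field_simps)
    finally show ?thesis by simp
  qed
  moreover have "1 / M \<le> L / M" using L M by (simp add: divide_right_mono)
  ultimately show ?thesis by linarith
qed

subsection \<open>Trigonometric polynomials\<close>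

text \<open>Makes the coefficient sequences explicit, where \<open>trig_polys\<close> only asserts
  that some exist.\<close>

definition trig_poly :: "(nat \<Rightarrow> real) \<Rightarrow> (nat \<Rightarrow> real) \<Rightarrow> nat \<Rightarrow> real \<Rightarrow> real" where
  "trig_poly \<alpha> \<beta> N \<theta> = \<alpha> 0 + (\<Sum>n=1..N. \<alpha> n * cos (real n * \<theta>) + \<beta> n * sin (real n * \<theta>))"

lemma trig_polys_iff: "u \<in> trig_polys N \<longleftrightarrow> (\<exists>\<alpha> \<beta>. u = trig_poly \<alpha> \<beta> N)"
  by (simp add: trig_polys_def trig_poly_def fun_eq_iff)

lemma continuous_on_trig_poly: "continuous_on S (trig_poly \<alpha> \<beta> N)"
  unfolding trig_poly_def by (intro continuous_intros)

lemma continuous_on_truncated_kernel: "continuous_on S (\<lambda>\<phi>. truncated_kernel N (\<theta> - \<phi>) r)"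
  unfolding truncated_kernel_def by (intro continuous_intros)

text \<open>By the addition theorem for the cosine, the kernel is a legitimate test function for the
  projection. The case \<open>n = 0\<close> is separate because the constant term is 1, not
  \<open>2 * r ^ 0\<close>.\<close>

lemma truncated_kernel_eq_trig_poly:
  "(\<lambda>\<phi>. truncated_kernel N (\<theta> - \<phi>) r) =
    trig_poly (\<lambda>n. if n = 0 then 1 else 2 * r ^ n * cos (real n * \<theta>)) (\<lambda>n. 2 * r ^ n * sin (real n * \<theta>)) N"
  unfolding truncated_kernel_def trig_poly_def sum_distrib_left
  by (auto simp: fun_eq_iff right_diff_distrib cos_diff algebra_simps intro!: sum.cong)

section \<open>Integrability and linearity of \<open>circle_inner\<close>\<close>

lemma set_integrable_continuous:
  "continuous_on {a..b} f \<Longrightarrow> set_integrable lborel {a..b} (f :: real \<Rightarrow> real)"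
  by (rule borel_integrable_atLeastAtMost')

lemma set_integrable_mult_continuous:
  fixes g v :: "real \<Rightarrow> real"
  assumes g: "set_integrable lborel {a..b} g" and v: "continuous_on {a..b} v"
  shows "set_integrable lborel {a..b} (\<lambda>x. g x * v x)"
proof -
  have "bounded (v ` {a..b})"
    using compact_continuous_image[OF v] compact_imp_bounded by auto
  then obtain C where C: "\<forall>x\<in>{a..b}. \<bar>v x\<bar> \<le> C"
    by (auto simp: bounded_iff)
  show ?thesis
  proof (rule set_integrable_bound)
    show "set_integrable lborel {a..b} (\<lambda>x. C * g x)"
      using g by (rule set_integrable_mult_right)
    \<comment> \<open>Nothing is known about \<open>g\<close> and \<open>v\<close> off the interval,
      so each factor is cut off before multiplying.\<close>
    have "(\<lambda>x. (indicator {a..b} x *\<^sub>R g x) * (indicator {a..b} x *\<^sub>R v x)) \<in> borel_measurable lborel"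
      using g set_integrable_continuous[OF v]
      by (intro borel_measurable_times) (auto simp: set_integrable_def)
    also have "(\<lambda>x. (indicator {a..b} x *\<^sub>R g x) * (indicator {a..b} x *\<^sub>R v x)) =
        (\<lambda>x. indicator {a..b} x *\<^sub>R (g x * v x))"
      by (auto simp: fun_eq_iff indicator_def)
    finally show "set_borel_measurable lborel {a..b} (\<lambda>x. g x * v x)"
      by (simp add: set_borel_measurable_def)
    show "AE x in lborel. x \<in> {a..b} \<longrightarrow> norm (g x * v x) \<le> norm (C * g x)"
    proof (intro AE_I2 impI)
      fix x assume "x \<in> {a..b}"
      then have "\<bar>v x\<bar> \<le> \<bar>C\<bar>" using C by force
      then show "norm (g x * v x) \<le> norm (C * g x)"
        by (simp add: abs_mult mult.commute[of "\<bar>C\<bar>"] mult_left_mono)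
    qed
  qed
qed

lemma circle_inner_commute: "circle_inner f h = circle_inner h f"
  by (simp add: circle_inner_def mult.commute)

lemma circle_inner_add_right:
  assumes "set_integrable lborel {0..2*pi} f" "continuous_on {0..2*pi} u" "continuous_on {0..2*pi} v"
  shows "circle_inner f (\<lambda>x. u x + v x) = circle_inner f u + circle_inner f v"
  unfolding circle_inner_def distrib_left
  using assms by (intro set_integral_add set_integrable_mult_continuous)

lemma circle_inner_scale_right: "circle_inner f (\<lambda>x. c * u x) = c * circle_inner f u"
  unfolding circle_inner_def by (simp add: mult.left_commute)

lemma circle_inner_diff_left:
  assumes "set_integrable lborel {0..2*pi} f" "set_integrable lborel {0..2*pi} h"
    "continuous_on {0..2*pi} v"
  shows "circle_inner (\<lambda>x. f x - h x) v = circle_inner f v - circle_inner h v"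
  unfolding circle_inner_def left_diff_distrib
  using assms by (intro set_integral_diff set_integrable_mult_continuous)

text \<open>Linearity reduces every pairing with a trigonometric polynomial to the Fourier
  coefficients of \<open>f\<close>; \<open>f\<close> may be \<open>g\<close> or itself a
  trigonometric polynomial.\<close>

lemma circle_inner_trig_poly:
  assumes f: "set_integrable lborel {0..2*pi} f"
  shows "circle_inner f (trig_poly \<alpha> \<beta> N) = \<alpha> 0 * circle_inner f (\<lambda>_. 1) +
    (\<Sum>n=1..N. \<alpha> n * circle_inner f (\<lambda>x. cos (real n * x)) + \<beta> n * circle_inner f (\<lambda>x. sin (real n * x)))"
proof (induction N)
  case 0
  have "trig_poly \<alpha> \<beta> 0 = (\<lambda>x. \<alpha> 0 * 1)" by (simp add: trig_poly_def fun_eq_iff)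
  then show ?case by (simp only: circle_inner_scale_right) simp
next
  case (Suc N)
  have "trig_poly \<alpha> \<beta> (Suc N) = (\<lambda>x. trig_poly \<alpha> \<beta> N x +
      (\<alpha> (Suc N) * cos (real (Suc N) * x) + \<beta> (Suc N) * sin (real (Suc N) * x)))"
    by (simp add: trig_poly_def fun_eq_iff)
  then have "circle_inner f (trig_poly \<alpha> \<beta> (Suc N)) = circle_inner f (trig_poly \<alpha> \<beta> N) +
      circle_inner f (\<lambda>x. \<alpha> (Suc N) * cos (real (Suc N) * x) + \<beta> (Suc N) * sin (real (Suc N) * x))"
    by (simp only:) (intro circle_inner_add_right f continuous_on_trig_poly continuous_intros)
  moreover have "circle_inner f (\<lambda>x. \<alpha> (Suc N) * cos (real (Suc N) * x) + \<beta> (Suc N) * sin (real (Suc N) * x)) =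
      circle_inner f (\<lambda>x. \<alpha> (Suc N) * cos (real (Suc N) * x)) +
      circle_inner f (\<lambda>x. \<beta> (Suc N) * sin (real (Suc N) * x))"
    by (intro circle_inner_add_right f continuous_intros)
  ultimately show ?case using Suc.IH by (simp add: circle_inner_scale_right)
qed

subsection \<open>Orthogonality\<close>

text \<open>Integer frequencies are allowed because the product formulas produce
  \<open>int n - int m\<close>, of either sign. For \<open>k \<noteq> 0\<close> the antiderivative
  agrees at both ends.\<close>

lemma integral_cos_int:
  "(LINT x:{0..2*pi}|lborel. cos (of_int k * x)) = (if k = 0 then 2 * pi else 0)"
proof (cases "k = 0")
  case False
  have "((\<lambda>x. cos (of_int k * x)) has_integral sin (of_int k * (2*pi)) / of_int k - sin (of_int k * 0) / of_int k) {0..2*pi}"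
    using False
    by (intro fundamental_theorem_of_calculus)
      (auto intro!: derivative_eq_intros simp flip: has_real_derivative_iff_has_vector_derivative)
  moreover have "sin (of_int k * (2*pi)) = 0"
    using sin_int_2pin[of k] by (simp add: mult.commute mult.left_commute)
  ultimately have "integral {0..2*pi} (\<lambda>x. cos (of_int k * x)) = 0" by (simp add: integral_unique)
  with False show ?thesis
    by (subst set_borel_integral_eq_integral) (auto intro!: set_integrable_continuous continuous_intros)
qed (simp add: set_integral_const)

lemma integral_sin_int:
  "(LINT x:{0..2*pi}|lborel. sin (of_int k * x)) = 0"
proof (cases "k = 0")
  case False
  have "((\<lambda>x. sin (of_int k * x)) has_integral - cos (of_int k * (2*pi)) / of_int k - - cos (of_int k * 0) / of_int k) {0..2*pi}"
    using False
    by (intro fundamental_theorem_of_calculus)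
      (auto intro!: derivative_eq_intros simp flip: has_real_derivative_iff_has_vector_derivative)
  moreover have "cos (of_int k * (2*pi)) = 1"
    using cos_int_2pin[of k] by (simp add: mult.commute mult.left_commute)
  ultimately have "integral {0..2*pi} (\<lambda>x. sin (of_int k * x)) = 0" by (simp add: integral_unique)
  then show ?thesis
    by (subst set_borel_integral_eq_integral) (auto intro!: set_integrable_continuous continuous_intros)
qed simp

text \<open>Product-to-sum formula: for \<open>n = m\<close> the difference frequency contributes
  \<open>pi\<close>, and for \<open>n = m = 0\<close> the sum frequency contributes another
  \<open>pi\<close>.\<close>

lemma circle_inner_cos_cos:
  "circle_inner (\<lambda>x. cos (real n * x)) (\<lambda>x. cos (real m * x)) =
    (if n = m then if n = 0 then 2 * pi else pi else 0)"
proof -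
  have "circle_inner (\<lambda>x. cos (real n * x)) (\<lambda>x. cos (real m * x)) =
     (LINT x:{0..2*pi}|lborel. (cos (of_int (int n - int m) * x) + cos (of_int (int n + int m) * x)) / 2)"
    by (simp add: circle_inner_def cos_times_cos left_diff_distrib distrib_right)
  also have "\<dots> = ((LINT x:{0..2*pi}|lborel. cos (of_int (int n - int m) * x)) +
      (LINT x:{0..2*pi}|lborel. cos (of_int (int n + int m) * x))) / 2"
    unfolding set_integral_divide_zero
    by (subst set_integral_add) (auto intro!: set_integrable_continuous continuous_intros)
  finally show ?thesis unfolding integral_cos_int by auto
qed

lemma circle_inner_sin_sin:
  "circle_inner (\<lambda>x. sin (real n * x)) (\<lambda>x. sin (real m * x)) =
    (if n = m \<and> n \<noteq> 0 then pi else 0)"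
proof -
  have "circle_inner (\<lambda>x. sin (real n * x)) (\<lambda>x. sin (real m * x)) =
     (LINT x:{0..2*pi}|lborel. (cos (of_int (int n - int m) * x) - cos (of_int (int n + int m) * x)) / 2)"
    by (simp add: circle_inner_def sin_times_sin left_diff_distrib distrib_right)
  also have "\<dots> = ((LINT x:{0..2*pi}|lborel. cos (of_int (int n - int m) * x)) -
      (LINT x:{0..2*pi}|lborel. cos (of_int (int n + int m) * x))) / 2"
    unfolding set_integral_divide_zero
    by (subst set_integral_diff) (auto intro!: set_integrable_continuous continuous_intros)
  finally show ?thesis unfolding integral_cos_int by auto
qed

lemma circle_inner_sin_cos:
  "circle_inner (\<lambda>x. sin (real n * x)) (\<lambda>x. cos (real m * x)) = 0"
proof -
  have "circle_inner (\<lambda>x. sin (real n * x)) (\<lambda>x. cos (real m * x)) =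
     (LINT x:{0..2*pi}|lborel. (sin (of_int (int n + int m) * x) + sin (of_int (int n - int m) * x)) / 2)"
    by (simp add: circle_inner_def sin_times_cos left_diff_distrib distrib_right)
  also have "\<dots> = ((LINT x:{0..2*pi}|lborel. sin (of_int (int n + int m) * x)) +
      (LINT x:{0..2*pi}|lborel. sin (of_int (int n - int m) * x))) / 2"
    unfolding set_integral_divide_zero
    by (subst set_integral_add) (auto intro!: set_integrable_continuous continuous_intros)
  finally show ?thesis unfolding integral_sin_int by simp
qed

lemma circle_inner_cos_sin:
  "circle_inner (\<lambda>x. cos (real n * x)) (\<lambda>x. sin (real m * x)) = 0"
  by (subst circle_inner_commute) (rule circle_inner_sin_cos)

text \<open>Orthogonality reads off the coefficients. The vanishing for \<open>k > N\<close> is what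
  later lets the kernel be truncated.\<close>

lemma circle_inner_trig_poly_cos:
  "circle_inner (trig_poly \<alpha> \<beta> N) (\<lambda>x. cos (real k * x)) =
    (if k = 0 then 2 * pi * \<alpha> 0 else if k \<le> N then pi * \<alpha> k else 0)"
proof -
  \<comment> \<open>The constant function is treated as the cosine of frequency 0, so the
    orthogonality relations cover it.\<close>
  have 0: "circle_inner f (\<lambda>_. 1) = circle_inner f (\<lambda>x. cos (real 0 * x))" for f by simp
  have "circle_inner (trig_poly \<alpha> \<beta> N) (\<lambda>x. cos (real k * x)) =
      circle_inner (\<lambda>x. cos (real k * x)) (trig_poly \<alpha> \<beta> N)"
    by (rule circle_inner_commute)
  also have "\<dots> = \<alpha> 0 * (if k = 0 then 2 * pi else 0) + (\<Sum>n=1..N. if n = k then \<alpha> n * pi else 0)"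
    unfolding circle_inner_trig_poly[OF set_integrable_continuous, OF continuous_on_cos[OF continuous_on_mult[OF continuous_on_const continuous_on_id]]]
    unfolding 0 circle_inner_cos_cos circle_inner_cos_sin
    by (intro arg_cong2[of _ _ _ _ "(+)"] sum.cong) auto
  finally show ?thesis by (auto simp: sum.delta)
qed

lemma circle_inner_trig_poly_sin:
  "circle_inner (trig_poly \<alpha> \<beta> N) (\<lambda>x. sin (real k * x)) =
    (if k \<noteq> 0 \<and> k \<le> N then pi * \<beta> k else 0)"
proof -
  have 0: "circle_inner f (\<lambda>_. 1) = circle_inner f (\<lambda>x. cos (real 0 * x))" for f by simp
  have "circle_inner (trig_poly \<alpha> \<beta> N) (\<lambda>x. sin (real k * x)) =
      circle_inner (\<lambda>x. sin (real k * x)) (trig_poly \<alpha> \<beta> N)"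
    by (rule circle_inner_commute)
  also have "\<dots> = (\<Sum>n=1..N. if n = k then \<beta> n * pi else 0)"
    unfolding circle_inner_trig_poly[OF set_integrable_continuous, OF continuous_on_sin[OF continuous_on_mult[OF continuous_on_const continuous_on_id]]]
    unfolding 0 circle_inner_sin_cos circle_inner_sin_sin
    by (simp only: mult_zero_right add_0_left) (intro sum.cong, auto)
  finally show ?thesis by (auto simp: sum.delta)
qed

text \<open>Only the constant coefficient 1 survives integration. The shift by
  \<open>\<theta>\<close> is the form in which the kernel enters a convolution.\<close>

lemma integral_truncated_kernel:
  "(LINT \<phi>:{0..2*pi}|lborel. truncated_kernel N (\<theta> - \<phi>) r) = 2 * pi"
proof -
  have "(LINT \<phi>:{0..2*pi}|lborel. truncated_kernel N (\<theta> - \<phi>) r) =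
     circle_inner (\<lambda>\<phi>. truncated_kernel N (\<theta> - \<phi>) r) (\<lambda>x. cos (real 0 * x))"
    by (simp add: circle_inner_def)
  also have "\<dots> = 2 * pi"
    unfolding truncated_kernel_eq_trig_poly circle_inner_trig_poly_cos by simp
  finally show ?thesis .
qed

lemma truncated_kernel_minus: "truncated_kernel N (- \<psi>) r = truncated_kernel N \<psi> r"
  by (simp add: truncated_kernel_def)

subsection \<open>The projection\<close>

text \<open>Fourier coefficients give existence, testing against single cosines and sines gives
  uniqueness. This justifies the definite description in \<open>trig_proj\<close>.\<close>

lemma trig_proj_unique_exists:
  assumes g: "set_integrable lborel {0..2*pi} g"
  shows "\<exists>!u. u \<in> trig_polys N \<and> (\<forall>v\<in>trig_polys N. circle_inner (\<lambda>\<theta>. g \<theta> - u \<theta>) v = 0)"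
proof (rule ex_ex1I)
  \<comment> \<open>The normalisation changes at \<open>n = 0\<close> because the constant 1 has
    squared norm \<open>2 * pi\<close>.\<close>
  define \<alpha> where "\<alpha> n = circle_inner g (\<lambda>x. cos (real n * x)) / (if n = 0 then 2 * pi else pi)" for n
  define \<beta> where "\<beta> n = circle_inner g (\<lambda>x. sin (real n * x)) / pi" for n
  have int: "set_integrable lborel {0..2*pi} (trig_poly a b N)" for a b
    by (intro set_integrable_continuous continuous_on_trig_poly)
  have one: "circle_inner f (\<lambda>_. 1) = circle_inner f (\<lambda>x. cos (real 0 * x))" for f by simp
  have "circle_inner (\<lambda>\<theta>. g \<theta> - trig_poly \<alpha> \<beta> N \<theta>) (trig_poly a b N) = 0" for a b
  proof -
    have "circle_inner (trig_poly \<alpha> \<beta> N) (trig_poly a b N) = circle_inner g (trig_poly a b N)"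
      unfolding circle_inner_trig_poly[OF int] circle_inner_trig_poly[OF g] one
        circle_inner_trig_poly_cos circle_inner_trig_poly_sin
      by (intro arg_cong2[of _ _ _ _ "(+)"] sum.cong) (auto simp: \<alpha>_def \<beta>_def)
    then show ?thesis
      by (simp add: circle_inner_diff_left g int continuous_on_trig_poly)
  qed
  then show "\<exists>u. u \<in> trig_polys N \<and> (\<forall>v\<in>trig_polys N. circle_inner (\<lambda>\<theta>. g \<theta> - u \<theta>) v = 0)"
    by (intro exI[of _ "trig_poly \<alpha> \<beta> N"]) (auto simp: trig_polys_iff)
next
  fix u v
  assume u: "u \<in> trig_polys N \<and> (\<forall>w\<in>trig_polys N. circle_inner (\<lambda>\<theta>. g \<theta> - u \<theta>) w = 0)"
    and v: "v \<in> trig_polys N \<and> (\<forall>w\<in>trig_polys N. circle_inner (\<lambda>\<theta>. g \<theta> - v \<theta>) w = 0)"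
  obtain a b c d where uv: "u = trig_poly a b N" "v = trig_poly c d N"
    using u v by (auto simp: trig_polys_iff)
  have int: "set_integrable lborel {0..2*pi} (trig_poly a b N)" for a b
    by (intro set_integrable_continuous continuous_on_trig_poly)
  \<comment> \<open>Both candidates have the same pairing with \<open>w\<close> as
    \<open>g\<close>.\<close>
  have eq: "circle_inner u w = circle_inner v w" if "w \<in> trig_polys N" for w
  proof -
    have w: "continuous_on {0..2*pi} w"
      using that by (auto simp: trig_polys_iff continuous_on_trig_poly)
    have "circle_inner g w = circle_inner (trig_poly a b N) w" if "trig_poly a b N = u \<or> trig_poly a b N = v" for a b
      using circle_inner_diff_left[OF g int w, of a b] u v that \<open>w \<in> trig_polys N\<close> by auto
    then show ?thesis using uv by metis
  qed
  have cos_mem: "(\<lambda>x. cos (real n * x)) \<in> trig_polys N" if "n \<le> N" for n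
    unfolding trig_polys_iff using that
    by (intro exI[of _ "\<lambda>k. if k = n then 1 else 0"] exI[of _ "\<lambda>_. 0"])
      (auto simp: trig_poly_def fun_eq_iff if_distrib[of "\<lambda>x. x * _"] sum.delta cong: if_cong)
  have sin_mem: "(\<lambda>x. sin (real n * x)) \<in> trig_polys N" if "n \<le> N" "n \<noteq> 0" for n
    unfolding trig_polys_iff using that
    by (intro exI[of _ "\<lambda>_. 0"] exI[of _ "\<lambda>k. if k = n then 1 else 0"])
      (auto simp: trig_poly_def fun_eq_iff if_distrib[of "\<lambda>x. x * _"] sum.delta cong: if_cong)
  have "a n = c n" if "n \<le> N" for n
    using eq[OF cos_mem[OF that]] that by (auto simp: uv circle_inner_trig_poly_cos split: if_splits)
  moreover have "b n = d n" if "n \<le> N" "n \<noteq> 0" for n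
    using eq[OF sin_mem[OF that]] that by (auto simp: uv circle_inner_trig_poly_sin split: if_splits)
  \<comment> \<open>The coefficients agree on the indices that \<open>trig_poly\<close> evaluates,
    which gives equality as functions.\<close>
  ultimately show "u = v"
    by (auto simp: uv trig_poly_def fun_eq_iff intro!: sum.cong)
qed

lemma trig_proj:
  assumes "set_integrable lborel {0..2*pi} g"
  shows trig_proj_in: "trig_proj N g \<in> trig_polys N"
    and circle_inner_trig_proj: "\<And>v. v \<in> trig_polys N \<Longrightarrow> circle_inner (trig_proj N g) v = circle_inner g v"
proof -
  have *: "trig_proj N g \<in> trig_polys N \<and>
     (\<forall>v\<in>trig_polys N. circle_inner (\<lambda>\<theta>. g \<theta> - trig_proj N g \<theta>) v = 0)"
    by (rule theI'[OF trig_proj_unique_exists[OF assms], folded trig_proj_def])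
  then show "trig_proj N g \<in> trig_polys N" by simp
  fix v assume v: "v \<in> trig_polys N"
  have "continuous_on {0..2*pi} v" "continuous_on {0..2*pi} (trig_proj N g)"
    using v * by (auto simp: trig_polys_iff continuous_on_trig_poly)
  then show "circle_inner (trig_proj N g) v = circle_inner g v"
    using circle_inner_diff_left[OF assms set_integrable_continuous] * v by fastforce
qed

section \<open>Harmonic extension of trigonometric polynomials as convolution with the truncated
  kernel\<close>

lemma circle_inner_truncated_kernel_stable:
  assumes u: "u \<in> trig_polys N" and "N \<le> M"
  shows "circle_inner u (\<lambda>\<phi>. truncated_kernel M (\<theta> - \<phi>) r) = circle_inner u (\<lambda>\<phi>. truncated_kernel N (\<theta> - \<phi>) r)"
proof -
  obtain a b where ab: "u = trig_poly a b N" using u by (auto simp: trig_polys_iff)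
  have int: "set_integrable lborel {0..2*pi} (trig_poly a b N)" for a b
    by (intro set_integrable_continuous continuous_on_trig_poly)
  show ?thesis
    unfolding ab truncated_kernel_eq_trig_poly circle_inner_trig_poly[OF int]
      circle_inner_trig_poly_cos circle_inner_trig_poly_sin
    \<comment> \<open>The kernel coefficients do not depend on the truncation, and \<open>u\<close>
      is orthogonal to all frequencies from \<open>Suc N\<close> to \<open>M\<close>.\<close>
    using \<open>N \<le> M\<close> by (intro arg_cong2[of _ _ _ _ "(+)"] sum.mono_neutral_right refl) auto
qed

lemma continuous_on_poisson_kernel:
  assumes r: "0 \<le> r" "r < 1"
  shows "continuous_on S (\<lambda>\<phi>. poisson_kernel (\<theta> - \<phi>) r)"
  unfolding poisson_kernel_def
  using poisson_denominator_pos[OF r] by (intro continuous_intros ballI less_imp_neq[THEN not_sym])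

text \<open>The kernels for \<open>M \<ge> N\<close> all pair equally with \<open>u\<close> and
  converge uniformly in the angle to the Poisson kernel, so no infinite series is integrated term by
  term.\<close>

lemma harmonic_extension_trig_poly:
  assumes u: "u \<in> trig_polys N" and r: "0 \<le> r" "r < 1"
  shows "harmonic_extension u \<theta> r = 1 / (2 * pi) * circle_inner u (\<lambda>\<phi>. truncated_kernel N (\<theta> - \<phi>) r)"
proof -
  let ?P = "circle_inner u (\<lambda>\<phi>. poisson_kernel (\<theta> - \<phi>) r)"
  let ?K = "\<lambda>M. circle_inner u (\<lambda>\<phi>. truncated_kernel M (\<theta> - \<phi>) r)"
  define C where "C = (LINT \<phi>:{0..2*pi}|lborel. \<bar>u \<phi>\<bar>)"
  have cu: "continuous_on {0..2*pi} u"
    using u by (auto simp: trig_polys_iff continuous_on_trig_poly)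
  note conts = cu continuous_on_poisson_kernel[OF r] continuous_on_truncated_kernel
  have bound: "\<bar>?P - ?K N\<bar> \<le> r ^ Suc M * (2 * (1 + r) / (1 - r)\<^sup>2 * C)" if "N \<le> M" for M
  proof -
    have "?P - ?K N = ?P - ?K M"
      using circle_inner_truncated_kernel_stable[OF u that] by simp
    also have "\<dots> = (LINT \<phi>:{0..2*pi}|lborel. u \<phi> * (poisson_kernel (\<theta> - \<phi>) r - truncated_kernel M (\<theta> - \<phi>) r))"
      unfolding circle_inner_def right_diff_distrib
      by (intro set_integral_diff(2)[symmetric] set_integrable_continuous continuous_on_mult conts)
    also have "\<bar>\<dots>\<bar> \<le> (LINT \<phi>:{0..2*pi}|lborel. \<bar>u \<phi> * (poisson_kernel (\<theta> - \<phi>) r - truncated_kernel M (\<theta> - \<phi>) r)\<bar>)"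
      using set_integral_norm_bound[of lborel "{0..2*pi}" "\<lambda>\<phi>. u \<phi> * (poisson_kernel (\<theta> - \<phi>) r - truncated_kernel M (\<theta> - \<phi>) r)"]
      by (simp add: set_integrable_continuous continuous_on_mult continuous_on_diff conts)
    also have "\<dots> \<le> (LINT \<phi>:{0..2*pi}|lborel. (2 * r ^ Suc M * (1 + r) / (1 - r)\<^sup>2) * \<bar>u \<phi>\<bar>)"
    proof (rule set_integral_mono)
      fix \<phi> :: real
      show "\<bar>u \<phi> * (poisson_kernel (\<theta> - \<phi>) r - truncated_kernel M (\<theta> - \<phi>) r)\<bar>
          \<le> (2 * r ^ Suc M * (1 + r) / (1 - r)\<^sup>2) * \<bar>u \<phi>\<bar>"
        unfolding abs_mult using poisson_kernel_approx[OF r, of "\<theta> - \<phi>" M]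
        by (subst mult.commute) (rule mult_right_mono, auto)
    qed (intro set_integrable_continuous continuous_intros conts)+
    also have "\<dots> = r ^ Suc M * (2 * (1 + r) / (1 - r)\<^sup>2 * C)"
      by (simp add: C_def)
    finally show ?thesis .
  qed
  \<comment> \<open>The bounded quantity is independent of \<open>M\<close>, so letting
    \<open>M\<close> grow forces it to be 0.\<close>
  have "(\<lambda>M. r ^ Suc M * (2 * (1 + r) / (1 - r)\<^sup>2 * C)) \<longlonglongrightarrow> 0"
    using LIMSEQ_Suc[OF LIMSEQ_realpow_zero[OF r]] by (rule tendsto_mult_left_zero)
  then have "\<bar>?P - ?K N\<bar> \<le> 0"
    by (rule LIMSEQ_le_const) (use bound in blast)
  then show ?thesis
    by (simp add: harmonic_extension_def circle_inner_def mult.commute)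
qed

subsection \<open>Piecewise continuous functions\<close>

text \<open>Off \<open>Z\<close> continuity supplies the one-sided limits, so they exist at every
  \<open>x\<close> here; each bounds \<open>g\<close> on its side of \<open>x\<close>.\<close>

lemma piecewise_C_locally_bounded:
  assumes g: "g \<in> piecewise_C Z" and x: "x \<in> {0..<2*pi}"
  shows "\<exists>d>0. \<exists>B. \<forall>y. \<bar>y - x\<bar> < d \<longrightarrow> \<bar>g y\<bar> \<le> B"
proof -
  have "\<exists>l. (g \<longlongrightarrow> l) (at_left x)" "\<exists>l. (g \<longlongrightarrow> l) (at_right x)"
  proof (atomize (full), cases "x \<in> Z")
    case False
    then have "(g \<longlongrightarrow> g x) (at x)" using g x by (auto simp: piecewise_C_def isCont_def)
    then show "(\<exists>l. (g \<longlongrightarrow> l) (at_left x)) \<and> (\<exists>l. (g \<longlongrightarrow> l) (at_right x))"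
      by (auto simp: filterlim_at_split)
  qed (use g in \<open>auto simp: piecewise_C_def\<close>)
  then obtain l m where l: "(g \<longlongrightarrow> l) (at_left x)" and m: "(g \<longlongrightarrow> m) (at_right x)"
    by blast
  \<comment> \<open>The value \<open>g x\<close> enters separately, since on \<open>Z\<close> it is
    unrelated to the one-sided limits.\<close>
  define B where "B = max \<bar>g x\<bar> (max (\<bar>l\<bar> + 1) (\<bar>m\<bar> + 1))"
  have "eventually (\<lambda>y. \<bar>g y\<bar> \<le> B) (at_left x)"
    using tendstoD[OF l, of 1] by (rule eventually_mono) (auto simp: dist_real_def B_def)
  moreover have "eventually (\<lambda>y. \<bar>g y\<bar> \<le> B) (at_right x)"
    using tendstoD[OF m, of 1] by (rule eventually_mono) (auto simp: dist_real_def B_def)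
  ultimately have "eventually (\<lambda>y. \<bar>g y\<bar> \<le> B) (at x)"
    by (simp add: eventually_at_split)
  then obtain d where "d > 0" "\<And>y. y \<noteq> x \<Longrightarrow> dist y x < d \<Longrightarrow> \<bar>g y\<bar> \<le> B"
    by (auto simp: eventually_at)
  moreover have "\<bar>g x\<bar> \<le> B" by (simp add: B_def)
  ultimately show ?thesis by (metis dist_real_def)
qed

text \<open>Bisection: boundedness passes to adjoining intervals and holds on short intervals around
  each point.\<close>

lemma piecewise_C_bounded:
  assumes g: "g \<in> piecewise_C Z"
  shows "bounded (g ` {0..2*pi})"
proof -
  have "(0::real) \<le> 2*pi" by simp
  then show ?thesis
  proof (induction rule: Bolzano)
    case (trans a b c)
    then have "{a..c} = {a..b} \<union> {b..c}" by auto
    with trans show ?case by (simp add: image_Un)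
  next
    case (local x)
    have "\<exists>d>0. \<exists>B. \<forall>y. \<bar>y - x\<bar> < d \<longrightarrow> \<bar>g y\<bar> \<le> B"
    proof (cases "x = 2*pi")
      \<comment> \<open>The regularity conditions cover angles in \<open>{0..<2 * pi}\<close>; at
        the right end periodicity carries over the bound from a two-sided neighbourhood of
        0.\<close>
      case True
      obtain d B where d: "d > 0" "\<And>y. \<bar>y - 0\<bar> < d \<Longrightarrow> \<bar>g y\<bar> \<le> B"
        using piecewise_C_locally_bounded[OF g, of 0] by auto
      have per: "g (y + 2*pi) = g y" for y
        using g by (simp add: piecewise_C_def circle_functions_def)
      have "\<bar>g y\<bar> \<le> B" if "\<bar>y - x\<bar> < d" for y
        using d(2)[of "y - 2*pi"] per[of "y - 2*pi"] that True by simp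
      then show ?thesis using d(1) by blast
    next
      case False
      then show ?thesis using piecewise_C_locally_bounded[OF g, of x] local by auto
    qed
    then obtain d B where d: "d > 0" "\<And>y. \<bar>y - x\<bar> < d \<Longrightarrow> \<bar>g y\<bar> \<le> B" by blast
    show ?case
    proof (intro exI[of _ d] conjI allI impI)
      fix a b assume ab: "a \<le> x \<and> x \<le> b \<and> b - a < d"
      then have "\<forall>y\<in>{a..b}. \<bar>g y\<bar> \<le> B" using d by (auto intro!: d(2))
      then show "bounded (g ` {a..b})" by (auto simp: bounded_iff)
    qed (fact d)
  qed
qed

text \<open>Off finitely many points \<open>g\<close> is continuous on an open set, which gives
  measurability; boundedness on a finite interval then gives integrability.\<close>

lemma piecewise_C_set_integrable:
  assumes g: "g \<in> piecewise_C Z" and Z: "finite Z"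
  shows "set_integrable lborel {0..2*pi} g"
proof -
  obtain B where B: "\<forall>x\<in>{0..2*pi}. \<bar>g x\<bar> \<le> B"
    using piecewise_C_bounded[OF g] by (auto simp: bounded_iff)
  have "open ({0<..<2*pi} - Z)" using Z by (intro open_Diff finite_imp_closed) auto
  moreover have "continuous_on ({0<..<2*pi} - Z) g"
    using g by (intro continuous_at_imp_continuous_on) (auto simp: piecewise_C_def)
  ultimately have "(\<lambda>x. indicator ({0<..<2*pi} - Z) x *\<^sub>R g x) \<in> borel_measurable lborel"
    using borel_measurable_continuous_on_indicator[OF borel_open, of "{0<..<2*pi} - Z" g] by simp
  \<comment> \<open>Both endpoints join the exceptional set, because the open set above leaves them
    out.\<close>
  then have "(\<lambda>x. indicator {0..2*pi} x *\<^sub>R g x) \<in> borel_measurable lborel"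
  proof (rule measurable_discrete_difference[where X = "insert 0 (insert (2*pi) Z)"])
    show "countable (insert 0 (insert (2*pi) Z))" using Z by (simp add: countable_finite)
    fix x :: real assume "x \<notin> insert 0 (insert (2*pi) Z)"
    then have "x \<in> {0<..<2*pi} - Z \<longleftrightarrow> x \<in> {0..2*pi}" by auto
    then show "indicator ({0<..<2*pi} - Z) x *\<^sub>R g x = indicator {0..2*pi} x *\<^sub>R g x"
      by (simp only: indicator_def)
  qed simp_all
  then have "set_borel_measurable lborel {0..2*pi} g" by (simp add: set_borel_measurable_def)
  moreover have "set_integrable lborel {0..2*pi} (\<lambda>_. B)"
    by (intro set_integrable_continuous continuous_intros)
  moreover have "AE x in lborel. x \<in> {0..2*pi} \<longrightarrow> norm (g x) \<le> norm B"
    using B by (intro AE_I2) force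
  ultimately show ?thesis using set_integrable_bound by blast
qed

section \<open>Averages against the nonnegative kernel and the maximum principle\<close>

theorem theorem5p3:
  fixes N :: nat
  assumes "N \<ge> 4"
  shows "(\<forall>(\<theta>, r)\<in>B1_plus N. truncated_kernel N \<theta> r \<ge> 0) \<and>
    (\<forall>r. 0 \<le> r \<and> r < 1 \<longrightarrow>
       1 / (2 * pi) * (LINT \<psi>:{0..2 * pi}|lborel. truncated_kernel N \<psi> r) = 1) \<and>
    (\<forall>Z g. finite Z \<and> Z \<subseteq> {0..<2 * pi} \<and> g \<in> piecewise_C Z \<longrightarrow>
       (\<forall>(\<theta>, r)\<in>B1_plus N.
          (INF \<phi>\<in>{0..<2 * pi}. g \<phi>) \<le> harmonic_extension (trig_proj N g) \<theta> r \<and>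
          harmonic_extension (trig_proj N g) \<theta> r \<le> (SUP \<phi>\<in>{0..<2 * pi}. g \<phi>)))"
proof -
  \<comment> \<open>Nonnegativity is recorded at every angle \<open>\<psi>\<close>, since the
    convolution uses all of them.\<close>
  have B1: "0 \<le> r \<and> r < 1 \<and> (\<forall>\<psi>. 0 \<le> truncated_kernel N \<psi> r)" if "(\<theta>, r) \<in> B1_plus N" for \<theta> r
  proof -
    have r: "0 \<le> r" "r \<le> r_star N" "r < 1" using that by (auto simp: B1_plus_def)
    then show ?thesis using truncated_kernel_nonneg r_star_power_le[OF assms r] by auto
  qed
  \<comment> \<open>The shifted integral at \<open>\<theta> = 0\<close>, combined with evenness of
    the kernel.\<close>
  have mean: "1 / (2 * pi) * (LINT \<psi>:{0..2*pi}|lborel. truncated_kernel N \<psi> r) = 1" for r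
    using integral_truncated_kernel[of N 0 r] by (simp add: truncated_kernel_minus)
  have bounds: "(INF \<phi>\<in>{0..<2*pi}. g \<phi>) \<le> harmonic_extension (trig_proj N g) \<theta> r \<and>
      harmonic_extension (trig_proj N g) \<theta> r \<le> (SUP \<phi>\<in>{0..<2*pi}. g \<phi>)"
    if Z: "finite Z" and g: "g \<in> piecewise_C Z" and "(\<theta>, r) \<in> B1_plus N" for Z g \<theta> r
  proof -
    let ?K = "\<lambda>\<phi>. truncated_kernel N (\<theta> - \<phi>) r"
    have r: "0 \<le> r" "r < 1" and nonneg: "\<And>\<psi>. 0 \<le> truncated_kernel N \<psi> r"
      using B1 that by auto
    note int = piecewise_C_set_integrable[OF g Z]
    have "harmonic_extension (trig_proj N g) \<theta> r = 1 / (2*pi) * circle_inner (trig_proj N g) ?K"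
      by (rule harmonic_extension_trig_poly[OF trig_proj_in[OF int] r])
    \<comment> \<open>The kernel lies in \<open>trig_polys N\<close> as a function of
      \<open>\<phi>\<close>, so the projection may be replaced by \<open>g\<close>.\<close>
    also have "circle_inner (trig_proj N g) ?K = circle_inner g ?K"
      by (rule circle_inner_trig_proj[OF int])
        (unfold truncated_kernel_eq_trig_poly trig_polys_iff, blast)
    finally have ext: "harmonic_extension (trig_proj N g) \<theta> r = 1 / (2*pi) * circle_inner g ?K" .
    have intK: "set_integrable lborel {0..2*pi} (\<lambda>\<phi>. g \<phi> * ?K \<phi>)"
      "set_integrable lborel {0..2*pi} (\<lambda>\<phi>. c * ?K \<phi>)" for c
      by (intro set_integrable_mult_continuous int set_integrable_continuous
          continuous_on_truncated_kernel continuous_intros)+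
    have const: "(LINT \<phi>:{0..2*pi}|lborel. c * ?K \<phi>) = 2 * pi * c" for c
      by (simp add: integral_truncated_kernel)
    have "bounded (g ` {0..<2*pi})"
      by (rule bounded_subset[OF piecewise_C_bounded[OF g]]) auto
    \<comment> \<open>The real \<open>INF\<close> and \<open>SUP\<close> bound the values only once
      the range is known to be bounded.\<close>
    then have bdd: "bdd_below (g ` {0..<2*pi})" "bdd_above (g ` {0..<2*pi})"
      by (simp_all add: bounded_imp_bdd_below bounded_imp_bdd_above)
    \<comment> \<open>The integral runs over the closed interval, the extrema over the half-open
      one; periodicity handles \<open>2 * pi\<close>.\<close>
    have *: "(INF \<phi>\<in>{0..<2*pi}. g \<phi>) \<le> g x \<and> g x \<le> (SUP \<phi>\<in>{0..<2*pi}. g \<phi>)"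
      if "x \<in> {0..2*pi}" for x
    proof -
      have "g (2*pi) = g 0"
        using g by (auto simp: piecewise_C_def circle_functions_def dest: spec[of _ 0])
      then have "\<exists>y\<in>{0..<2*pi}. g y = g x"
        using that by (cases "x = 2*pi") force+
      then obtain y where "y \<in> {0..<2*pi}" "g y = g x" by blast
      then show ?thesis using bdd by (metis cINF_lower cSUP_upper)
    qed
    \<comment> \<open>The constant is rewritten as its own integral against the kernel, and the
      integrands are compared pointwise using \<open>nonneg\<close>.\<close>
    have "2 * pi * (INF \<phi>\<in>{0..<2*pi}. g \<phi>) \<le> circle_inner g ?K"
      unfolding circle_inner_def const[symmetric]
      by (intro set_integral_mono intK mult_right_mono) (use * nonneg in auto)
    moreover have "circle_inner g ?K \<le> 2 * pi * (SUP \<phi>\<in>{0..<2*pi}. g \<phi>)"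
      unfolding circle_inner_def const[symmetric]
      by (intro set_integral_mono intK mult_right_mono) (use * nonneg in auto)
    ultimately show ?thesis unfolding ext by (simp add: field_simps)
  qed
  show ?thesis using B1 mean bounds by blast
qed

end
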